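(* Let $d\in\mathbb N$ and $\lambda_0,\lambda_1,\ldots,\lambda_d\in\mathbb R\setminus\{0\}$. The $d\times d$ matrix $$G=\Bigl(\frac1{\lambda_0}+\frac{\delta_{ij}}{\lambda_i}\Bigr)_{i,j=1}^d$$ is positive definite if and only if one of the following cases occurs: (A) all numbers $\lambda_0,\lambda_1,\ldots,\lambda_d$ are positive; (B) one of $\lambda_0,\lambda_1,\ldots,\lambda_d$ is negative, all others are positive, and $\lambda_0+\lambda_1+\cdots+\lambda_d<0$.
   Context: $\delta_{ij}$ is the Kronecker delta, so $G$ has diagonal entries $\frac1{\lambda_i}+\frac1{\lambda_0}$ and all off-diagonal entries $\frac1{\lambda_0}$. *)

theory Defs
  imports "Jordan_Normal_Form.Matrix"
begin

definition positive_definite :: "real mat \<Rightarrow> bool" where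
  "positive_definite A \<longleftrightarrow> square_mat A \<and> transpose_mat A = A \<and>
     (\<forall>v \<in> carrier_vec (dim_row A). v \<noteq> 0\<^sub>v (dim_row A) \<longrightarrow> v \<bullet> (A *\<^sub>v v) > 0)"

text \<open>Matrix indices are 0-based, so entry \<open>(i, j)\<close> below is the entry of \<open>G\<close>
  in row \<open>i + 1\<close>, column \<open>j + 1\<close>; the parameters \<open>lam 0, ..., lam d\<close> keep their indices.\<close>

definition G_mat :: "nat \<Rightarrow> (nat \<Rightarrow> real) \<Rightarrow> real mat" where
  "G_mat d lam = mat d d (\<lambda>(i, j). 1 / lam 0 + (if i = j then 1 else 0) / lam (Suc i))"

end

theory Submission
  imports Defs
begin

text \<open>
  With \<open>w\<^sub>0 = - (v\<^sub>1 + \<dots> + v\<^sub>d)\<close> and \<open>w\<^sub>i = v\<^sub>i\<close> the quadratic form of \<open>G\<close> becomes the diagonal form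
  \<open>\<Sum> w\<^sub>i\<^sup>2 / \<lambda>\<^sub>i\<close> on the hyperplane \<open>\<Sum> w\<^sub>i = 0\<close>, so all the \<open>\<lambda>\<^sub>i\<close> play the same role.
  Two negative coefficients are excluded by a difference of two unit vectors. If only \<open>\<lambda>\<^sub>k\<close> is
  negative, the Cauchy-Schwarz inequality \<open>w\<^sub>k\<^sup>2 \<le> (\<Sum>\<^bsub>i \<noteq> k\<^esub> \<lambda>\<^sub>i) (\<Sum>\<^bsub>i \<noteq> k\<^esub> w\<^sub>i\<^sup>2 / \<lambda>\<^sub>i)\<close> decides the
  sign, and its equality case \<open>w\<^sub>i = \<lambda>\<^sub>i\<close> (\<open>i \<noteq> k\<close>) shows that the condition is sharp.
\<close>

text \<open>With S, W, T the three sums, the nonnegative terms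
  \<open>(S * w i - W * lam i)\<^sup>2 / lam i\<close> add up to S * (S * T - W^2), and S > 0 can be
  cancelled.\<close>

lemma weighted_Cauchy_Schwarz:
  fixes lam w :: "'a \<Rightarrow> real"
  assumes "finite I" and pos: "\<And>i. i \<in> I \<Longrightarrow> lam i > 0"
  shows "(sum w I)\<^sup>2 \<le> sum lam I * (\<Sum>i\<in>I. (w i)\<^sup>2 / lam i)"
proof (cases "I = {}")
  case False
  define S W T where "S = sum lam I" and "W = sum w I" and "T = (\<Sum>i\<in>I. (w i)\<^sup>2 / lam i)"
  have S: "S > 0"
    unfolding S_def using assms False by (intro sum_pos) auto
  have "0 \<le> (\<Sum>i\<in>I. (S * w i - W * lam i)\<^sup>2 / lam i)"
    by (intro sum_nonneg divide_nonneg_nonneg) (auto simp: less_imp_le pos)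
  also have "\<dots> = (\<Sum>i\<in>I. S\<^sup>2 * ((w i)\<^sup>2 / lam i) - 2 * S * W * w i + W\<^sup>2 * lam i)"
    by (intro sum.cong refl) (use pos in \<open>force simp: field_simps power2_eq_square\<close>)
  also have "\<dots> = S\<^sup>2 * T - 2 * S * W * W + W\<^sup>2 * S"
    by (simp only: sum.distrib sum_subtractf sum_distrib_left[symmetric]
        S_def[symmetric] W_def[symmetric] T_def[symmetric])
  also have "\<dots> = S * (S * T - W\<^sup>2)"
    by (simp add: algebra_simps power2_eq_square)
  finally show ?thesis
    using S by (simp add: zero_le_mult_iff S_def W_def T_def)
qed simp

lemma diagonal_form_pos_if_one_negative:
  fixes lam w :: "'a \<Rightarrow> real"
  assumes fin: "finite I" and k: "k \<in> I" "lam k < 0"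
    and pos: "\<And>i. i \<in> I - {k} \<Longrightarrow> lam i > 0"
    and neg: "sum lam I < 0" and w0: "sum w I = 0" and j: "j \<in> I" "w j \<noteq> 0"
  shows "(\<Sum>i\<in>I. (w i)\<^sup>2 / lam i) > 0"
proof -
  define S T where "S = sum lam (I - {k})" and "T = (\<Sum>i\<in>I - {k}. (w i)\<^sup>2 / lam i)"
  have wk: "w k = - sum w (I - {k})"
    using w0 fin k by (simp add: sum.remove)
  \<comment> \<open>A nonzero coordinate away from \<open>k\<close> makes T positive, so that S < -
    \<open>lam k\<close> yields a strict inequality after multiplying by T. If there were none,
    \<open>wk\<close> would force \<open>w k\<close> = 0 as well.\<close>
  obtain i where i: "i \<in> I - {k}" "w i \<noteq> 0"
  proof (rule ccontr)
    assume "\<not> thesis"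
    then have z: "w i = 0" if "i \<in> I - {k}" for i
      using that \<open>\<And>i. \<lbrakk>i \<in> I - {k}; w i \<noteq> 0\<rbrakk> \<Longrightarrow> thesis\<close> by blast
    then have "w k = 0"
      by (simp add: wk)
    with z j show False
      by (cases "j = k") auto
  qed
  have T: "T > 0"
    unfolding T_def using fin i pos
    by (intro sum_pos2[of _ i]) (auto simp: less_imp_le)
  have "(w k)\<^sup>2 \<le> S * T"
    using weighted_Cauchy_Schwarz[of "I - {k}" lam w] fin pos by (simp add: wk S_def T_def)
  also have "\<dots> < - lam k * T"
    using neg fin k T by (intro mult_strict_right_mono) (auto simp: S_def sum.remove)
  finally have "T + (w k)\<^sup>2 / lam k > 0"
    using k by (simp add: field_simps)
  then show ?thesis
    using fin k by (simp add: T_def sum.remove add.commute)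
qed

lemma diagonal_form_pos_on_sum_zero_iff:
  fixes lam :: "'a \<Rightarrow> real"
  assumes fin: "finite I" and nz: "\<And>i. i \<in> I \<Longrightarrow> lam i \<noteq> 0"
  shows "(\<forall>w. sum w I = 0 \<and> (\<exists>i\<in>I. w i \<noteq> 0) \<longrightarrow> (\<Sum>i\<in>I. (w i)\<^sup>2 / lam i) > 0) \<longleftrightarrow>
    (\<forall>i\<in>I. lam i > 0) \<or>
    (\<exists>k\<in>I. lam k < 0 \<and> (\<forall>i\<in>I - {k}. lam i > 0) \<and> sum lam I < 0)"
    (is "?P \<longleftrightarrow> ?A \<or> ?B")
proof
  assume P: ?P
  show "?A \<or> ?B"
  proof (cases ?A)
    case False
    then obtain k where k: "k \<in> I" "lam k < 0"
      using nz by (metis linorder_neqE_linordered_idom)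
    have pos: "lam j > 0" if j: "j \<in> I - {k}" for j
    proof (rule ccontr)
      assume "\<not> lam j > 0"
      then have neg: "lam j < 0"
        using nz[of j] j by auto
      have jk: "k \<noteq> j"
        using j by blast
      \<comment> \<open>The difference of unit vectors lies in the hyperplane, and only the two
        negative coefficients contribute to its form.\<close>
      define w :: "'a \<Rightarrow> real" where "w i = (if i = j then 1 else if i = k then -1 else 0)" for i
      have split: "sum f I = f k + f j + sum f (I - {k} - {j})" for f :: "'a \<Rightarrow> real"
        using fin j k by (simp add: sum.remove[of I k] sum.remove[of "I - {k}" j] add.assoc)
      have "sum w I = 0"
        using jk by (simp add: split w_def)
      moreover have "w j \<noteq> 0"
        by (simp add: w_def)
      moreover have "(\<Sum>i\<in>I. (w i)\<^sup>2 / lam i) = 1 / lam k + 1 / lam j"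
        using jk by (simp add: split w_def)
      ultimately have "1 / lam k + 1 / lam j > 0"
        using P j by (metis DiffD1)
      moreover have "1 / lam k < 0" "1 / lam j < 0"
        using k neg by auto
      ultimately show False
        by linarith
    qed
    define S where "S = sum lam (I - {k})"
    have sum: "sum lam I = lam k + S"
      using fin k by (simp add: S_def sum.remove)
    have "sum lam I < 0"
    \<comment> \<open>If \<open>k\<close> is the only index, \<open>?P\<close> is vacuous, but the
      whole sum is \<open>lam k\<close> < 0. For the matrix this is d = 0.\<close>
    proof (cases "I - {k} = {}")
      case True
      then show ?thesis
        using k unfolding sum S_def True by simp
    next
      case False
      then have S: "S > 0"
        unfolding S_def using fin pos by (intro sum_pos) auto
      \<comment> \<open>The equality case of Cauchy-Schwarz, with the entry at \<open>k\<close>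
        chosen to make the sum zero. The form takes the value (\<open>lam k\<close> + S) * (S /
        \<open>lam k\<close>), whose second factor is negative.\<close>
      define w where "w = lam(k := - S)"
      have rest: "sum w (I - {k}) = S" "(\<Sum>i\<in>I - {k}. (w i)\<^sup>2 / lam i) = S"
        unfolding S_def by (auto intro!: sum.cong simp: w_def power2_eq_square nz)
      have "sum w I = 0"
        using fin k rest by (simp add: sum.remove w_def)
      moreover have "w k \<noteq> 0"
        using S by (simp add: w_def)
      ultimately have "0 < (\<Sum>i\<in>I. (w i)\<^sup>2 / lam i)"
        using P k by blast
      also have "\<dots> = S\<^sup>2 / lam k + S"
        using fin k rest(2) by (simp add: sum.remove[of I k] w_def)
      also have "\<dots> = (lam k + S) * (S / lam k)"
        using k by (simp add: field_simps power2_eq_square)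
      finally show ?thesis
        using S k by (simp add: sum zero_less_mult_iff zero_less_divide_iff mult_less_0_iff)
    qed
    with k pos show ?thesis
      by blast
  qed simp
next
  assume "?A \<or> ?B"
  then show ?P
  proof
    assume ?A
    then show ?P
      using fin by (auto intro!: sum_pos2 divide_nonneg_nonneg simp: less_imp_le)
  next
    assume ?B
    then show ?P
      using diagonal_form_pos_if_one_negative[OF fin] by blast
  qed
qed

text \<open>G is a diagonal matrix plus 1 / \<lambda>_0 times the all-ones matrix, and the latter
  contributes the squared coordinate sum.\<close>

lemma quadratic_form_G_mat:
  assumes v: "v \<in> carrier_vec d"
  shows "v \<bullet> (G_mat d lam *\<^sub>v v) =
    (\<Sum>i<d. v $ i)\<^sup>2 / lam 0 + (\<Sum>i<d. (v $ i)\<^sup>2 / lam (Suc i))"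
proof -
  have row: "(G_mat d lam *\<^sub>v v) $ i = (\<Sum>j<d. v $ j) / lam 0 + v $ i / lam (Suc i)"
    if "i < d" for i
  proof -
    have "(G_mat d lam *\<^sub>v v) $ i =
        (\<Sum>j<d. v $ j / lam 0 + (if i = j then v $ i / lam (Suc i) else 0))"
      using that v
      by (auto simp: G_mat_def scalar_prod_def atLeast0LessThan algebra_simps intro!: sum.cong)
    then show ?thesis
      using that by (simp add: sum.distrib sum_divide_distrib)
  qed
  have dim: "dim_row (G_mat d lam) = d"
    by (simp add: G_mat_def)
  have "v \<bullet> (G_mat d lam *\<^sub>v v) =
      (\<Sum>i<d. v $ i * ((\<Sum>j<d. v $ j) / lam 0 + v $ i / lam (Suc i)))"
    unfolding scalar_prod_def
    by (rule sum.cong) (auto simp: dim row simp del: index_mult_mat_vec)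
  then show ?thesis
    by (simp add: distrib_left sum.distrib sum_divide_distrib[symmetric]
        sum_distrib_right[symmetric] power2_eq_square)
qed

text \<open>Prepending minus the coordinate sum is a linear bijection from R^d onto the hyperplane
  of sum zero in R^(d+1), so nonzero vectors correspond to nonzero vectors.\<close>

lemma positive_definite_G_mat_iff:
  "positive_definite (G_mat d lam) \<longleftrightarrow>
    (\<forall>w :: nat \<Rightarrow> real. sum w {0..d} = 0 \<and> (\<exists>i\<in>{0..d}. w i \<noteq> 0) \<longrightarrow> (\<Sum>i=0..d. (w i)\<^sup>2 / lam i) > 0)"
    (is "_ \<longleftrightarrow> ?P")
proof -
  have split: "sum f {0..d} = f 0 + (\<Sum>i<d. f (Suc i))" for f :: "nat \<Rightarrow> real"
    by (simp add: atLeast0AtMost lessThan_Suc_atMost[symmetric] sum.lessThan_Suc_shift del: sum.lessThan_Suc)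
  have "positive_definite (G_mat d lam) \<longleftrightarrow>
      (\<forall>v \<in> carrier_vec d. v \<noteq> 0\<^sub>v d \<longrightarrow> v \<bullet> (G_mat d lam *\<^sub>v v) > 0)"
  proof -
    have "square_mat (G_mat d lam)" "transpose_mat (G_mat d lam) = G_mat d lam"
      "dim_row (G_mat d lam) = d"
      by (auto simp: G_mat_def)
    then show ?thesis
      by (simp add: positive_definite_def)
  qed
  also have "\<dots> \<longleftrightarrow> ?P"
  proof
    assume L: "\<forall>v \<in> carrier_vec d. v \<noteq> 0\<^sub>v d \<longrightarrow> v \<bullet> (G_mat d lam *\<^sub>v v) > 0"
    show ?P
    proof (intro allI impI, elim conjE bexE)
      fix w :: "nat \<Rightarrow> real" and j
      assume w: "sum w {0..d} = 0" and j: "j \<in> {0..d}" "w j \<noteq> 0"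
      define v where "v = vec d (\<lambda>i. w (Suc i))"
      have vi: "v $ i = w (Suc i)" if "i < d" for i
        using that by (auto simp: v_def)
      have vc: "v \<in> carrier_vec d"
        by (simp add: v_def)
      have w0: "w 0 = - (\<Sum>i<d. w (Suc i))"
        using w by (simp add: split)
      have "v \<noteq> 0\<^sub>v d"
      proof
        assume "v = 0\<^sub>v d"
        then have z: "w (Suc i) = 0" if "i < d" for i
          using vi[OF that] that by simp
        then have "w 0 = 0"
          by (simp add: w0)
        with z j show False
          by (cases j) auto
      qed
      with L vc have "v \<bullet> (G_mat d lam *\<^sub>v v) > 0"
        by blast
      then show "(\<Sum>i=0..d. (w i)\<^sup>2 / lam i) > 0"
        by (simp add: quadratic_form_G_mat[OF vc] vi split w0)
    qed
  next
    assume P: ?P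
    show "\<forall>v \<in> carrier_vec d. v \<noteq> 0\<^sub>v d \<longrightarrow> v \<bullet> (G_mat d lam *\<^sub>v v) > 0"
    proof (intro ballI impI)
      fix v :: "real vec"
      assume v: "v \<in> carrier_vec d" and nz: "v \<noteq> 0\<^sub>v d"
      \<comment> \<open>Coordinate i of \<open>v\<close> moves to index i + 1. Sums over
        \<open>{0..d}\<close> read \<open>v\<close> only at indices below \<open>d\<close>, where
        its entries are specified.\<close>
      define w where "w = case_nat (- (\<Sum>i<d. v $ i)) (($) v)"
      have "sum w {0..d} = 0"
        by (simp add: split w_def)
      moreover obtain i where "i < d" "v $ i \<noteq> 0"
        using v nz by (metis carrier_vecD eq_vecI index_zero_vec(1) index_zero_vec(2))
      then have "\<exists>i\<in>{0..d}. w i \<noteq> 0"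
        by (intro bexI[of _ "Suc i"]) (auto simp: w_def)
      ultimately have "(\<Sum>i=0..d. (w i)\<^sup>2 / lam i) > 0"
        using P by blast
      then show "v \<bullet> (G_mat d lam *\<^sub>v v) > 0"
        by (simp add: quadratic_form_G_mat[OF v] split w_def)
    qed
  qed
  finally show ?thesis .
qed

theorem lemma3p2:
  fixes d :: nat and lam :: "nat \<Rightarrow> real"
  assumes "\<forall>i\<in>{0..d}. lam i \<noteq> 0"
  shows "positive_definite (G_mat d lam) \<longleftrightarrow>
    (\<forall>i\<in>{0..d}. lam i > 0) \<or>
    (\<exists>k\<in>{0..d}. lam k < 0 \<and> (\<forall>i\<in>{0..d} - {k}. lam i > 0) \<and> (\<Sum>i=0..d. lam i) < 0)"
  unfolding positive_definite_G_mat_iff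
  using assms by (intro diagonal_form_pos_on_sum_zero_iff) auto

end
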